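(* Let $S,P,Q$ be pairwise disjoint finite sets and consider the equation $\mathcal{K}_{SP}\leftrightarrow\mathcal{K}_{PQ}=\mathcal{K}_{SQ}$, where $\mathcal{K}_{SP},\mathcal{K}_{PQ},\mathcal{K}_{SQ}$ are generalized number lattices on $S\uplus P$, $P\uplus Q$, $S\uplus Q$ respectively. Then 1. given $\mathcal{K}_{SP},\mathcal{K}_{SQ}$, there exists a generalized number lattice $\mathcal{K}_{PQ}$ satisfying the equation iff $\mathcal{K}_{SP}\circ S\supseteq\mathcal{K}_{SQ}\circ S$ and $\mathcal{K}_{SP}\times S\subseteq\mathcal{K}_{SQ}\times S$; 2. given $\mathcal{K}_{SP},\mathcal{K}_{PQ},\mathcal{K}_{SQ}$ satisfying the equation, we have $\mathcal{K}_{SP}\leftrightarrow\mathcal{K}_{SQ}=\mathcal{K}_{PQ}$ iff $\mathcal{K}_{SP}\circ P\supseteq\mathcal{K}_{PQ}\circ P$ and $\mathcal{K}_{SP}\times P\subseteq\mathcal{K}_{PQ}\times P$; 3. given $\mathcal{K}_{SP},\mathcal{K}_{SQ}$, if the equation is satisfied by some generalized number lattice $\hat{\mathcal{K}}_{PQ}$ with $\mathcal{K}_{SP}\circ P\supseteq\hat{\mathcal{K}}_{PQ}\circ P$ and $\mathcal{K}_{SP}\times P\subseteq\hat{\mathcal{K}}_{PQ}\times P$, then it is the unique such solution.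
   Context: All vectors are over $\mathbb{Q}$; a vector on a finite set $X$ is a function $X\to\mathbb{Q}$, $0_X$ the zero vector, $(f_X,g_Y)$ the vector on $X\uplus Y$ formed from $f_X,g_Y$. A number lattice on $X$ is the set of all integer linear combinations of finitely many vectors on $X$; a generalized number lattice on $X$ is a set $L_X+\mathcal{V}_X$ with $L_X$ a number lattice and $\mathcal{V}_X$ a vector subspace. Restriction: $\mathcal{K}_{SP}\circ S=\{f_S:\exists f_P,(f_S,f_P)\in\mathcal{K}_{SP}\}$; contraction: $\mathcal{K}_{SP}\times S=\{f_S:(f_S,0_P)\in\mathcal{K}_{SP}\}$. Matched composition of $\mathcal{K}_{AB},\mathcal{K}_{BC}$ ($A,B,C$ pairwise disjoint, sets of vectors indexed by sets so $\mathcal{K}_{AB}=\mathcal{K}_{BA}$): $\mathcal{K}_{AB}\leftrightarrow\mathcal{K}_{BC}=\{(f_A,g_C):\exists h_B,\ (f_A,h_B)\in\mathcal{K}_{AB},(h_B,g_C)\in\mathcal{K}_{BC}\}$. *)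

theory Defs
  imports Complex_Main "HOL-Library.Function_Algebras"
begin

(* A vector on X, i.e. a function X -> Q, is encoded by its extension by zero to the whole type.
   Hence the zero vector on any set is 0, and for disjoint X, Y the vector (f_X, g_Y) on the
   union of X and Y is the pointwise sum f + g. *)
definition vecs :: "'a set \<Rightarrow> ('a \<Rightarrow> rat) set" where
  "vecs X = {f. \<forall>x. x \<notin> X \<longrightarrow> f x = 0}"

definition vscale :: "rat \<Rightarrow> ('a \<Rightarrow> rat) \<Rightarrow> 'a \<Rightarrow> rat" where
  "vscale c f = (\<lambda>x. c * f x)"

interpretation ratvec: vector_space "vscale :: rat \<Rightarrow> ('a \<Rightarrow> rat) \<Rightarrow> 'a \<Rightarrow> rat"
  by unfold_locales (simp_all add: vscale_def fun_eq_iff algebra_simps)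

definition number_lattice :: "'a set \<Rightarrow> ('a \<Rightarrow> rat) set \<Rightarrow> bool" where
  "number_lattice X L \<longleftrightarrow>
    (\<exists>B. finite B \<and> B \<subseteq> vecs X \<and>
         L = {(\<Sum>b\<in>B. vscale (rat_of_int (c b)) b) | c :: ('a \<Rightarrow> rat) \<Rightarrow> int. True})"

definition gen_number_lattice :: "'a set \<Rightarrow> ('a \<Rightarrow> rat) set \<Rightarrow> bool" where
  "gen_number_lattice X K \<longleftrightarrow>
    (\<exists>L V. number_lattice X L \<and> V \<subseteq> vecs X \<and> ratvec.subspace V \<and>
           K = {l + v | l v. l \<in> L \<and> v \<in> V})"

(* In the next two definitions K is a set of vectors on the disjoint union of S and P,
   and the result is a set of vectors on S. *)
definition restriction :: "('a \<Rightarrow> rat) set \<Rightarrow> 'a set \<Rightarrow> 'a set \<Rightarrow> ('a \<Rightarrow> rat) set" where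
  "restriction K S P = {f \<in> vecs S. \<exists>g \<in> vecs P. f + g \<in> K}"

(* (f_S, 0_P) is f itself, so P does not occur. *)
definition contraction :: "('a \<Rightarrow> rat) set \<Rightarrow> 'a set \<Rightarrow> ('a \<Rightarrow> rat) set" where
  "contraction K S = {f \<in> vecs S. f \<in> K}"

definition matched_comp ::
  "'a set \<Rightarrow> 'a set \<Rightarrow> 'a set \<Rightarrow> ('a \<Rightarrow> rat) set \<Rightarrow> ('a \<Rightarrow> rat) set \<Rightarrow> ('a \<Rightarrow> rat) set" where
  "matched_comp A B C K\<^sub>1 K\<^sub>2 =
    {f + g | f g. f \<in> vecs A \<and> g \<in> vecs C \<and>
                  (\<exists>h \<in> vecs B. f + h \<in> K\<^sub>1 \<and> h + g \<in> K\<^sub>2)}"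

end

theory Submission
  imports Defs "HOL-Library.Set_Algebras"
begin

text \<open>
  Write \<open>K \<leftrightarrow> M\<close> for matched composition. For subgroups \<open>K\<close> and \<open>M\<close>, the identity
  \<open>K \<leftrightarrow> (K \<leftrightarrow> M) = M\<close> is equivalent to the restriction and contraction inclusions, and
  these inclusions hold whenever \<open>M\<close> has the form \<open>K \<leftrightarrow> N\<close>. So \<open>K_SP \<leftrightarrow> K_SQ\<close> is the
  canonical solution, and exchanging \<open>S\<close> and \<open>P\<close> turns the first claim into the other two.
  That \<open>K \<leftrightarrow> M\<close> is again a generalized number lattice holds because it is a coordinate
  projection of an intersection: the generalized number lattices are the groups that are finitely
  generated modulo a rational subspace, and since the integers form a principal ideal domain,
  being finitely generated modulo \<open>V\<close> passes to subgroups \<open>H\<close>, with \<open>V\<close> replaced by \<open>H \<inter> V\<close>.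
\<close>

section \<open>Modules over Euclidean rings\<close>

lemma euclidean_ring_ideal_principal:
  fixes I :: "'a::euclidean_ring set"
  assumes zero: "0 \<in> I"
    and diff: "\<And>a b. a \<in> I \<Longrightarrow> b \<in> I \<Longrightarrow> a - b \<in> I"
    and mult: "\<And>a r. a \<in> I \<Longrightarrow> a * r \<in> I"
  obtains d where "d \<in> I" "\<And>a. a \<in> I \<Longrightarrow> d dvd a"
proof (cases "I \<subseteq> {0}")
  case True
  then show thesis using that zero by blast
next
  case False
  then obtain d where d: "d \<in> I" "d \<noteq> 0"
    and minimal: "\<And>a. a \<in> I \<Longrightarrow> a \<noteq> 0 \<Longrightarrow> euclidean_size d \<le> euclidean_size a"
    using ex_has_least_nat[of "\<lambda>a. a \<in> I \<and> a \<noteq> 0" _ euclidean_size] by blast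
  have "d dvd a" if "a \<in> I" for a
  proof -
    have "a mod d \<in> I"
      using diff[OF that mult[OF d(1), of "a div d"]] by (simp add: minus_mult_div_eq_mod)
    then have "a mod d = 0"
      using minimal mod_size_less[OF d(2), of a] by (meson not_less)
    then show ?thesis by (rule mod_0_imp_dvd)
  qed
  then show thesis using that d(1) by blast
qed

lemma set_plus_eq_Collect: "A + B = {a + b | a b. a \<in> A \<and> b \<in> B}"
  by (auto simp: set_plus_def)

(* Lemmas placed in the locale module itself would be captured by its unqualified interpretation
   for real vector spaces. *)
locale euclidean_module = module scale
  for scale :: "'r::euclidean_ring \<Rightarrow> 'm::ab_group_add \<Rightarrow> 'm" (infixr \<open>*s\<close> 75)
begin

lemma span_Un_set_plus: "span (A \<union> B) = span A + span B"
  by (simp add: span_Un set_plus_eq_Collect)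

lemma subspace_set_plus:
  assumes "subspace U" "subspace V"
  shows "subspace (U + V)"
  using subspace_span[of "U \<union> V"] assms[THEN span_eq_iff[THEN iffD2]]
  by (simp add: span_Un_set_plus)

lemma subspace_set_plus_subset:
  assumes "subspace U" "A \<subseteq> U" "B \<subseteq> U"
  shows "A + B \<subseteq> U"
  using assms by (auto elim!: set_plus_elim intro: subspace_add)

definition finitely_generated_modulo :: "'m set \<Rightarrow> 'm set \<Rightarrow> bool" where
  "finitely_generated_modulo V K \<longleftrightarrow> (\<exists>B. finite B \<and> K = span B + V)"

lemma finitely_generated_modulo_refl: "finitely_generated_modulo V V"
  unfolding finitely_generated_modulo_def by (intro exI[of _ "{}"]) simp

lemma finitely_generated_modulo_trans:
  assumes "finitely_generated_modulo U V" "finitely_generated_modulo V K"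
  shows "finitely_generated_modulo U K"
proof -
  obtain B C where "finite B" "V = span B + U" and "finite C" "K = span C + V"
    using assms unfolding finitely_generated_modulo_def by blast
  then have "finite (C \<union> B)" "K = span (C \<union> B) + U"
    by (simp_all add: span_Un_set_plus add.assoc)
  then show ?thesis unfolding finitely_generated_modulo_def by blast
qed

lemma finitely_generated_modulo_set_plus:
  assumes "finitely_generated_modulo V K" "finitely_generated_modulo W M"
  shows "finitely_generated_modulo (V + W) (K + M)"
proof -
  obtain B C where "finite B" "K = span B + V" and "finite C" "M = span C + W"
    using assms unfolding finitely_generated_modulo_def by blast
  then have "finite (B \<union> C)" "K + M = span (B \<union> C) + (V + W)"
    by (simp_all add: span_Un_set_plus ac_simps)
  then show ?thesis unfolding finitely_generated_modulo_def by blast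
qed

lemma finitely_generated_modulo_imp_subset:
  "finitely_generated_modulo V K \<Longrightarrow> V \<subseteq> K"
  unfolding finitely_generated_modulo_def using set_zero_plus2[OF span_zero] by blast

lemma finitely_generated_modulo_imp_subspace:
  "finitely_generated_modulo V K \<Longrightarrow> subspace V \<Longrightarrow> subspace K"
  unfolding finitely_generated_modulo_def using subspace_set_plus[OF subspace_span] by blast

lemma subspace_cyclic_modulo:
  assumes H: "subspace H" and A: "subspace A" and HA: "H \<subseteq> span {b} + A"
  obtains h where "H = span {h} + (H \<inter> A)"
proof -
  note HA_subspace = subspace_set_plus[OF H A]
  define I where "I = {r. r *s b \<in> H + A}"
  have "0 \<in> I"
    using subspace_0[OF HA_subspace] by (simp add: I_def)
  moreover have "r - s \<in> I" if "r \<in> I" "s \<in> I" for r s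
    using that subspace_diff[OF HA_subspace] by (simp add: I_def scale_left_diff_distrib)
  moreover have "r * s \<in> I" if "r \<in> I" for r s
    using that subspace_scale[OF HA_subspace, of "r *s b" s] by (simp add: I_def mult.commute)
  ultimately obtain d where d: "d \<in> I" and d_dvd: "\<And>r. r \<in> I \<Longrightarrow> d dvd r"
    using euclidean_ring_ideal_principal by blast
  obtain h a where h: "h \<in> H" and a: "a \<in> A" and db: "d *s b = h + a"
    using d unfolding I_def by (auto elim: set_plus_elim)
  have "x \<in> span {h} + (H \<inter> A)" if x: "x \<in> H" for x
  proof -
    obtain r a' where a': "a' \<in> A" and x_eq: "x = r *s b + a'"
      using subsetD[OF HA x] by (auto simp: span_singleton elim: set_plus_elim)
    then have "r *s b = x + - a'" by simp
    then have "r \<in> I"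
      using set_plus_intro[OF x subspace_neg[OF A a']] by (simp add: I_def)
    then obtain k where k: "r = k * d" using d_dvd by (metis dvd_def mult.commute)
    have "r *s b = k *s h + k *s a"
      by (simp add: k db scale_right_distrib flip: scale_scale)
    then have "x - k *s h = k *s a + a'" by (simp add: x_eq)
    then have "x - k *s h \<in> A"
      using subspace_add[OF A subspace_scale[OF A a] a'] by simp
    then have "x - k *s h \<in> H \<inter> A"
      using subspace_diff[OF H x subspace_scale[OF H h]] by blast
    moreover have "k *s h \<in> span {h}" by (simp add: span_singleton)
    ultimately show ?thesis by (metis add.commute diff_add_cancel set_plus_intro)
  qed
  moreover have "span {h} + (H \<inter> A) \<subseteq> H"
    using h by (intro subspace_set_plus_subset[OF H] span_minimal[OF _ H]) auto
  ultimately show thesis using that by blast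
qed

lemma finitely_generated_modulo_subspace:
  assumes V: "subspace V" and K: "finitely_generated_modulo V K"
    and H: "subspace H" and HK: "H \<subseteq> K"
  shows "finitely_generated_modulo (H \<inter> V) H"
proof -
  obtain B where "finite B" "K = span B + V"
    using K unfolding finitely_generated_modulo_def by blast
  then show ?thesis
    using H HK
  proof (induction B arbitrary: K H rule: finite_induct)
    case empty
    then have "H \<inter> V = H" by auto
    then show ?case by (simp add: finitely_generated_modulo_refl)
  next
    case (insert b B)
    define A where "A = span B + V"
    have A: "subspace A"
      unfolding A_def by (rule subspace_set_plus[OF subspace_span V])
    have "H \<subseteq> span {b} + A"
      using insert.prems span_Un_set_plus[of "{b}" B] by (simp add: A_def add.assoc)
    then obtain h where "H = span {h} + (H \<inter> A)"
      by (rule subspace_cyclic_modulo[OF \<open>subspace H\<close> A])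
    then have "finitely_generated_modulo (H \<inter> A) H"
      unfolding finitely_generated_modulo_def by blast
    moreover have "finitely_generated_modulo (H \<inter> A \<inter> V) (H \<inter> A)"
      using insert.IH[OF A_def] subspace_inter[OF \<open>subspace H\<close> A] by simp
    moreover have "H \<inter> A \<inter> V = H \<inter> V"
      using set_zero_plus2[OF span_zero] unfolding A_def by blast
    ultimately show ?case by (metis finitely_generated_modulo_trans)
  qed
qed

lemma finitely_generated_modulo_Int:
  assumes V: "subspace V" "finitely_generated_modulo V K"
    and W: "subspace W" "finitely_generated_modulo W M"
  shows "finitely_generated_modulo (V \<inter> W) (K \<inter> M)"
proof -
  note K = finitely_generated_modulo_imp_subspace[OF V(2,1)]
  note M = finitely_generated_modulo_imp_subspace[OF W(2,1)]
  have "K \<inter> M \<inter> V = V \<inter> M" "V \<inter> M \<inter> W = V \<inter> W"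
    using V W finitely_generated_modulo_imp_subset by blast+
  then have "finitely_generated_modulo (V \<inter> M) (K \<inter> M)"
    and "finitely_generated_modulo (V \<inter> W) (V \<inter> M)"
    using finitely_generated_modulo_subspace[OF V subspace_inter[OF K M]]
      finitely_generated_modulo_subspace[OF W subspace_inter[OF V(1) M]] by simp_all
  then show ?thesis by (metis finitely_generated_modulo_trans)
qed

end

locale euclidean_module_hom =
  m1: euclidean_module s1 + m2: euclidean_module s2 + module_hom s1 s2 f
  for s1 :: "'r::euclidean_ring \<Rightarrow> 'm::ab_group_add \<Rightarrow> 'm"
    and s2 :: "'r \<Rightarrow> 'n::ab_group_add \<Rightarrow> 'n"
    and f :: "'m \<Rightarrow> 'n"
begin

lemma image_set_plus: "f ` (A + B) = f ` A + f ` B"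
  by (auto simp: set_plus_image image_iff add) (metis add)+

lemma finitely_generated_modulo_image:
  assumes "m1.finitely_generated_modulo V K"
  shows "m2.finitely_generated_modulo (f ` V) (f ` K)"
proof -
  obtain B where "finite B" "K = m1.span B + V"
    using assms unfolding m1.finitely_generated_modulo_def by blast
  then have "finite (f ` B)" "f ` K = m2.span (f ` B) + f ` V"
    by (simp_all add: image_set_plus span_image)
  then show ?thesis unfolding m2.finitely_generated_modulo_def by blast
qed

end

section \<open>Generalized number lattices\<close>

interpretation intvec:
  euclidean_module "\<lambda>n :: int. vscale (rat_of_int n) :: ('a \<Rightarrow> rat) \<Rightarrow> 'a \<Rightarrow> rat"
  by unfold_locales (simp_all add: vscale_def fun_eq_iff algebra_simps)

lemma subspace_vecs: "ratvec.subspace (vecs X)"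
  by (auto simp: ratvec.subspace_def vecs_def vscale_def)

lemma vecs_mono: "X \<subseteq> Y \<Longrightarrow> vecs X \<subseteq> vecs Y"
  by (auto simp: vecs_def)

lemma vecs_Int: "vecs (X \<inter> Y) = vecs X \<inter> vecs Y"
  by (auto simp: vecs_def)

lemma intvec_subspace_if_ratvec_subspace: "ratvec.subspace V \<Longrightarrow> intvec.subspace V"
  by (auto simp: ratvec.subspace_def intvec.subspace_def)

lemma number_lattice_iff_span:
  "number_lattice X L \<longleftrightarrow> (\<exists>B. finite B \<and> B \<subseteq> vecs X \<and> L = intvec.span B)"
  unfolding number_lattice_def by (auto simp: intvec.span_finite full_SetCompr_eq)

lemma gen_number_lattice_iff:
  "gen_number_lattice X K \<longleftrightarrow>
    K \<subseteq> vecs X \<and> (\<exists>V. ratvec.subspace V \<and> intvec.finitely_generated_modulo V K)"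
proof
  assume "gen_number_lattice X K"
  then obtain B V where B: "finite B" "B \<subseteq> vecs X" and V: "V \<subseteq> vecs X" "ratvec.subspace V"
    and K: "K = intvec.span B + V"
    unfolding gen_number_lattice_def number_lattice_iff_span by (auto simp: set_plus_eq_Collect)
  have "K \<subseteq> vecs X"
    unfolding K by (intro intvec.subspace_set_plus_subset intvec.span_minimal B V
        intvec_subspace_if_ratvec_subspace subspace_vecs)
  then show "K \<subseteq> vecs X \<and> (\<exists>V. ratvec.subspace V \<and> intvec.finitely_generated_modulo V K)"
    using B(1) V(2) K unfolding intvec.finitely_generated_modulo_def by blast
next
  assume "K \<subseteq> vecs X \<and> (\<exists>V. ratvec.subspace V \<and> intvec.finitely_generated_modulo V K)"
  then obtain B V where "K \<subseteq> vecs X" and V: "ratvec.subspace V"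
    and B: "finite B" and K: "K = intvec.span B + V"
    unfolding intvec.finitely_generated_modulo_def by blast
  moreover have "V \<subseteq> K"
    unfolding K by (rule set_zero_plus2[OF intvec.span_zero])
  moreover have "B \<subseteq> K"
    using intvec.span_superset[of B] set_zero_plus2[OF ratvec.subspace_0[OF V]]
    unfolding K by (metis add.commute order_trans)
  ultimately have "B \<subseteq> vecs X" "V \<subseteq> vecs X" by auto
  then show "gen_number_lattice X K"
    unfolding gen_number_lattice_def number_lattice_iff_span K set_plus_eq_Collect
    using B V by blast
qed

lemma gen_number_lattice_imp_vecs: "gen_number_lattice X K \<Longrightarrow> K \<subseteq> vecs X"
  by (simp add: gen_number_lattice_iff)

lemma gen_number_lattice_imp_subspace: "gen_number_lattice X K \<Longrightarrow> intvec.subspace K"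
  unfolding gen_number_lattice_iff
  using intvec.finitely_generated_modulo_imp_subspace intvec_subspace_if_ratvec_subspace by blast

lemma gen_number_lattice_vecs: "gen_number_lattice X (vecs X)"
  unfolding gen_number_lattice_iff
  using subspace_vecs intvec.finitely_generated_modulo_refl by blast

lemma gen_number_lattice_Int:
  assumes "gen_number_lattice X K" "gen_number_lattice Y M"
  shows "gen_number_lattice (X \<inter> Y) (K \<inter> M)"
proof -
  obtain V W where V: "ratvec.subspace V" "intvec.finitely_generated_modulo V K"
    and W: "ratvec.subspace W" "intvec.finitely_generated_modulo W M"
    using assms unfolding gen_number_lattice_iff by blast
  have "intvec.finitely_generated_modulo (V \<inter> W) (K \<inter> M)"
    using V W by (intro intvec.finitely_generated_modulo_Int intvec_subspace_if_ratvec_subspace)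
  moreover have "K \<inter> M \<subseteq> vecs (X \<inter> Y)"
    using assms[THEN gen_number_lattice_imp_vecs] vecs_Int by blast
  ultimately show ?thesis
    unfolding gen_number_lattice_iff using ratvec.subspace_inter[OF V(1) W(1)] by blast
qed

lemma gen_number_lattice_set_plus:
  assumes "gen_number_lattice X K" "gen_number_lattice Y M"
  shows "gen_number_lattice (X \<union> Y) (K + M)"
proof -
  obtain V W where V: "ratvec.subspace V" "intvec.finitely_generated_modulo V K"
    and W: "ratvec.subspace W" "intvec.finitely_generated_modulo W M"
    using assms unfolding gen_number_lattice_iff by blast
  have "K \<subseteq> vecs (X \<union> Y)" "M \<subseteq> vecs (X \<union> Y)"
    using assms[THEN gen_number_lattice_imp_vecs] vecs_mono[of _ "X \<union> Y"] by blast+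
  then have "K + M \<subseteq> vecs (X \<union> Y)"
    by (intro intvec.subspace_set_plus_subset intvec_subspace_if_ratvec_subspace subspace_vecs)
  moreover have "ratvec.subspace (V + W)"
    using ratvec.subspace_sums[OF V(1) W(1)] by (simp add: set_plus_eq_Collect)
  ultimately show ?thesis
    unfolding gen_number_lattice_iff
    using intvec.finitely_generated_modulo_set_plus[OF V(2) W(2)] by blast
qed

lemma gen_number_lattice_image:
  assumes p: "module_hom vscale vscale p" and K: "gen_number_lattice X K"
    and "p ` K \<subseteq> vecs Y"
  shows "gen_number_lattice Y (p ` K)"
proof -
  interpret rat: module_hom vscale vscale p by (rule p)
  interpret int: euclidean_module_hom "\<lambda>n. vscale (rat_of_int n)" "\<lambda>n. vscale (rat_of_int n)" p
    by unfold_locales (simp_all add: rat.add rat.scale)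
  obtain V where V: "ratvec.subspace V" "intvec.finitely_generated_modulo V K"
    using K unfolding gen_number_lattice_iff by blast
  show ?thesis
    unfolding gen_number_lattice_iff
    using assms(3) rat.subspace_image[OF V(1)] int.finitely_generated_modulo_image[OF V(2)] by blast
qed

section \<open>Coordinate projections\<close>

definition coord_proj :: "'a set \<Rightarrow> ('a \<Rightarrow> rat) \<Rightarrow> 'a \<Rightarrow> rat" where
  "coord_proj A f = (\<lambda>x. if x \<in> A then f x else 0)"

lemma coord_proj_in_vecs: "coord_proj A f \<in> vecs A"
  by (simp add: coord_proj_def vecs_def)

lemma module_hom_coord_proj: "module_hom vscale vscale (coord_proj A)"
  by unfold_locales (auto simp: coord_proj_def vscale_def algebra_simps)

lemmas coord_proj_add = module_hom.add[OF module_hom_coord_proj]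

lemma coord_proj_id: "f \<in> vecs X \<Longrightarrow> X \<subseteq> A \<Longrightarrow> coord_proj A f = f"
  by (auto simp: fun_eq_iff coord_proj_def vecs_def)

lemma coord_proj_eq_0: "f \<in> vecs X \<Longrightarrow> A \<inter> X = {} \<Longrightarrow> coord_proj A f = 0"
  by (auto simp: fun_eq_iff coord_proj_def vecs_def)

lemma coord_proj_Un: "A \<inter> B = {} \<Longrightarrow> coord_proj (A \<union> B) f = coord_proj A f + coord_proj B f"
  by (auto simp: fun_eq_iff coord_proj_def)

lemma coord_proj_add_eq_left:
  "f \<in> vecs A \<Longrightarrow> g \<in> vecs B \<Longrightarrow> A \<inter> B = {} \<Longrightarrow> coord_proj A (f + g) = f"
  by (simp add: coord_proj_add coord_proj_id coord_proj_eq_0)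

lemma vecs_Un_decompose:
  assumes "A \<inter> B = {}" "k \<in> vecs (A \<union> B)"
  obtains f g where "f \<in> vecs A" "g \<in> vecs B" "k = f + g"
  using assms coord_proj_Un[of A B k] coord_proj_id[of k "A \<union> B" "A \<union> B"] coord_proj_in_vecs
  by fastforce

lemma vecs_add_unique:
  assumes "A \<inter> B = {}" "f \<in> vecs A" "f' \<in> vecs A" "g \<in> vecs B" "g' \<in> vecs B" "f + g = f' + g'"
  shows "f = f'" "g = g'"
proof -
  show "f = f'"
    using coord_proj_add_eq_left assms by metis
  then show "g = g'" using assms(6) by simp
qed

section \<open>Matched composition\<close>

lemma mem_matched_comp_iff:
  assumes "A \<inter> C = {}" "f \<in> vecs A" "g \<in> vecs C"
  shows "f + g \<in> matched_comp A B C K M \<longleftrightarrow> (\<exists>h \<in> vecs B. f + h \<in> K \<and> h + g \<in> M)"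
proof
  assume "f + g \<in> matched_comp A B C K M"
  then obtain f' g' h where "f + g = f' + g'" "f' \<in> vecs A" "g' \<in> vecs C"
    and h: "h \<in> vecs B" "f' + h \<in> K" "h + g' \<in> M"
    unfolding matched_comp_def by blast
  then have "f = f'" "g = g'" using vecs_add_unique[OF assms(1)] assms(2,3) by blast+
  then show "\<exists>h \<in> vecs B. f + h \<in> K \<and> h + g \<in> M" using h by blast
qed (use assms(2,3) in \<open>auto simp: matched_comp_def\<close>)

lemma matched_comp_eq_coord_proj_image:
  assumes disj: "A \<inter> B = {}" "B \<inter> C = {}" "A \<inter> C = {}"
    and K: "K \<subseteq> vecs (A \<union> B)" and M: "M \<subseteq> vecs (B \<union> C)"
  shows "matched_comp A B C K M = coord_proj (A \<union> C) ` ((K + vecs C) \<inter> (M + vecs A))"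
proof (intro equalityI subsetI)
  fix x assume "x \<in> matched_comp A B C K M"
  then obtain f g h where x: "x = f + g" and f: "f \<in> vecs A" and g: "g \<in> vecs C"
    and h: "h \<in> vecs B" and mem: "f + h \<in> K" "h + g \<in> M"
    unfolding matched_comp_def by blast
  have "x = coord_proj (A \<union> C) (f + h + g)"
    using f g h disj coord_proj_eq_0[OF h, of "A \<union> C"]
    by (auto simp: x coord_proj_add coord_proj_id)
  moreover have "f + h + g \<in> K + vecs C" using mem(1) g by blast
  moreover have "h + g + f \<in> M + vecs A" using mem(2) f by blast
  then have "f + h + g \<in> M + vecs A" by (simp add: ac_simps)
  ultimately show "x \<in> coord_proj (A \<union> C) ` ((K + vecs C) \<inter> (M + vecs A))" by blast
next
  fix x assume "x \<in> coord_proj (A \<union> C) ` ((K + vecs C) \<inter> (M + vecs A))"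
  then obtain y k g f m where x: "x = coord_proj (A \<union> C) y"
    and k: "y = k + g" "k \<in> K" "g \<in> vecs C" and m: "y = m + f" "m \<in> M" "f \<in> vecs A"
    by (elim imageE IntE set_plus_elim) (rule that)
  have "coord_proj (A \<union> B) y = k"
    unfolding k(1) by (rule coord_proj_add_eq_left[OF subsetD[OF K k(2)] k(3)]) (use disj in auto)
  then have "coord_proj A y + coord_proj B y \<in> K"
    using k(2) coord_proj_Un[OF disj(1)] by metis
  moreover have "coord_proj (B \<union> C) y = m"
    unfolding m(1) by (rule coord_proj_add_eq_left[OF subsetD[OF M m(2)] m(3)]) (use disj in auto)
  then have "coord_proj B y + coord_proj C y \<in> M"
    using m(2) coord_proj_Un[OF disj(2)] by metis
  ultimately show "x \<in> matched_comp A B C K M"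
    unfolding x coord_proj_Un[OF disj(3)] matched_comp_def using coord_proj_in_vecs by blast
qed

lemma gen_number_lattice_matched_comp:
  assumes "A \<inter> B = {}" "B \<inter> C = {}" "A \<inter> C = {}"
    and K: "gen_number_lattice (A \<union> B) K" and M: "gen_number_lattice (B \<union> C) M"
  shows "gen_number_lattice (A \<union> C) (matched_comp A B C K M)"
proof -
  note lattices = gen_number_lattice_set_plus[OF K gen_number_lattice_vecs]
    gen_number_lattice_set_plus[OF M gen_number_lattice_vecs]
  show ?thesis
    unfolding matched_comp_eq_coord_proj_image[OF assms(1-3)
        K[THEN gen_number_lattice_imp_vecs] M[THEN gen_number_lattice_imp_vecs]]
    using gen_number_lattice_image[OF module_hom_coord_proj gen_number_lattice_Int[OF lattices]]
      coord_proj_in_vecs by blast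
qed

lemma restriction_matched_comp_subset:
  assumes "S \<inter> Q = {}"
  shows "restriction (matched_comp S P Q K M) S Q \<subseteq> restriction K S P"
  unfolding restriction_def using mem_matched_comp_iff[OF assms] by blast

lemma contraction_subset_matched_comp:
  assumes "0 \<in> M"
  shows "contraction K S \<subseteq> contraction (matched_comp S P Q K M) S"
proof
  fix f assume "f \<in> contraction K S"
  then have f: "f \<in> vecs S" "f + 0 \<in> K" by (auto simp: contraction_def)
  moreover have "0 \<in> vecs P" "0 \<in> vecs Q" "0 + 0 \<in> M" using assms by (auto simp: vecs_def)
  ultimately have "f + 0 \<in> matched_comp S P Q K M" unfolding matched_comp_def by blast
  then show "f \<in> contraction (matched_comp S P Q K M) S"
    using f(1) by (simp add: contraction_def)
qed

lemma matched_comp_imp_restriction_contraction: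
  assumes "S \<inter> Q = {}" "0 \<in> N" "matched_comp S P Q K N = M"
  shows "restriction M S Q \<subseteq> restriction K S P \<and> contraction K S \<subseteq> contraction M S"
  using restriction_matched_comp_subset[OF assms(1)] contraction_subset_matched_comp[OF assms(2)]
  unfolding assms(3)[symmetric] by blast

lemma matched_comp_matched_comp_subset:
  assumes disj: "P \<inter> Q = {}"
    and K: "intvec.subspace K" and M: "intvec.subspace M"
    and contr: "contraction K S \<subseteq> contraction M S"
  shows "matched_comp S P Q K (matched_comp P S Q K M) \<subseteq> M"
proof
  fix x assume "x \<in> matched_comp S P Q K (matched_comp P S Q K M)"
  then obtain f g h where x: "x = f + g" and f: "f \<in> vecs S" and "g \<in> vecs Q" "h \<in> vecs P"
    and fh: "f + h \<in> K" and "h + g \<in> matched_comp P S Q K M"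
    unfolding matched_comp_def[of S] by blast
  then obtain f' where f': "f' \<in> vecs S" and hf': "h + f' \<in> K" and f'g: "f' + g \<in> M"
    using mem_matched_comp_iff[OF disj] by blast
  have "f - f' \<in> K"
    using intvec.subspace_diff[OF K fh hf'] by (simp add: algebra_simps)
  then have "f - f' \<in> contraction K S"
    using ratvec.subspace_diff[OF subspace_vecs f f'] by (simp add: contraction_def)
  then have "f - f' \<in> M" using contr by (auto simp: contraction_def)
  then have "(f - f') + (f' + g) \<in> M" using f'g by (rule intvec.subspace_add[OF M])
  then show "x \<in> M" by (simp add: x)
qed

lemma subset_matched_comp_matched_comp:
  assumes disj: "S \<inter> Q = {}" and M: "M \<subseteq> vecs (S \<union> Q)"
    and restr: "restriction M S Q \<subseteq> restriction K S P"
  shows "M \<subseteq> matched_comp S P Q K (matched_comp P S Q K M)"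
proof
  fix x assume "x \<in> M"
  then obtain f g where f: "f \<in> vecs S" and g: "g \<in> vecs Q" and x: "x = f + g"
    using M vecs_Un_decompose[OF disj] by blast
  then have "f \<in> restriction K S P"
    using \<open>x \<in> M\<close> restr by (auto simp: restriction_def)
  then obtain h where h: "h \<in> vecs P" and fh: "f + h \<in> K" by (auto simp: restriction_def)
  have "h + f \<in> K" "f + g \<in> M"
    using fh \<open>x \<in> M\<close> by (simp_all add: x add.commute)
  then have "h + g \<in> matched_comp P S Q K M"
    using f g h unfolding matched_comp_def by blast
  then show "x \<in> matched_comp S P Q K (matched_comp P S Q K M)"
    using f g h fh unfolding x matched_comp_def[of S] by blast
qed

lemma matched_comp_matched_comp_eq_iff:
  assumes "S \<inter> Q = {}" "P \<inter> Q = {}"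
    and K: "intvec.subspace K" and M: "intvec.subspace M" "M \<subseteq> vecs (S \<union> Q)"
  shows "matched_comp S P Q K (matched_comp P S Q K M) = M \<longleftrightarrow>
    restriction M S Q \<subseteq> restriction K S P \<and> contraction K S \<subseteq> contraction M S"
    (is "?MM = M \<longleftrightarrow> ?inclusions")
proof
  assume "?MM = M"
  have "0 + 0 \<in> matched_comp P S Q K M"
    using mem_matched_comp_iff[OF assms(2), of 0 0] intvec.subspace_0[OF K]
      intvec.subspace_0[OF M(1)] ratvec.subspace_0[OF subspace_vecs] by force
  then show ?inclusions
    using \<open>?MM = M\<close> by (intro matched_comp_imp_restriction_contraction[OF assms(1)]) simp_all
next
  assume ?inclusions
  then show "?MM = M"
    using matched_comp_matched_comp_subset[OF assms(2) K M(1)]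
      subset_matched_comp_matched_comp[OF assms(1) M(2)] by (intro equalityI) simp_all
qed

theorem theorem3:
  fixes S P Q :: "'a set"
    and K_SP K_SQ :: "('a \<Rightarrow> rat) set"
  assumes "finite S" and "finite P" and "finite Q"
    and "S \<inter> P = {}" and "P \<inter> Q = {}" and "S \<inter> Q = {}"
    and "gen_number_lattice (S \<union> P) K_SP"
    and "gen_number_lattice (S \<union> Q) K_SQ"
  shows
    "((\<exists>K_PQ. gen_number_lattice (P \<union> Q) K_PQ \<and> matched_comp S P Q K_SP K_PQ = K_SQ) \<longleftrightarrow>
        restriction K_SP S P \<supseteq> restriction K_SQ S Q \<and>
        contraction K_SP S \<subseteq> contraction K_SQ S)
     \<and>
     (\<forall>K_PQ. gen_number_lattice (P \<union> Q) K_PQ \<longrightarrow> matched_comp S P Q K_SP K_PQ = K_SQ \<longrightarrow>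
        (matched_comp P S Q K_SP K_SQ = K_PQ \<longleftrightarrow>
           restriction K_SP P S \<supseteq> restriction K_PQ P Q \<and>
           contraction K_SP P \<subseteq> contraction K_PQ P))
     \<and>
     (\<forall>K_PQ. gen_number_lattice (P \<union> Q) K_PQ \<and> matched_comp S P Q K_SP K_PQ = K_SQ \<and>
        restriction K_SP P S \<supseteq> restriction K_PQ P Q \<and>
        contraction K_SP P \<subseteq> contraction K_PQ P \<longrightarrow>
        (\<forall>K'. gen_number_lattice (P \<union> Q) K' \<and> matched_comp S P Q K_SP K' = K_SQ \<and>
           restriction K_SP P S \<supseteq> restriction K' P Q \<and>
           contraction K_SP P \<subseteq> contraction K' P \<longrightarrow> K' = K_PQ))"
proof -
  have disj: "S \<inter> P = {}" "P \<inter> S = {}" "P \<inter> Q = {}" "S \<inter> Q = {}" using assms by auto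
  have subgroups: "intvec.subspace K_SP" "intvec.subspace K_SQ"
    using assms(7,8)[THEN gen_number_lattice_imp_subspace] .
  have vecs_SQ: "K_SQ \<subseteq> vecs (S \<union> Q)"
    using assms(8) by (rule gen_number_lattice_imp_vecs)
  let ?canonical = "matched_comp P S Q K_SP K_SQ"
  have canonical: "gen_number_lattice (P \<union> Q) ?canonical"
    using assms(7,8) disj by (intro gen_number_lattice_matched_comp) (simp_all add: Un_commute)
  have existence: "(\<exists>K_PQ. gen_number_lattice (P \<union> Q) K_PQ \<and> matched_comp S P Q K_SP K_PQ = K_SQ)
      \<longleftrightarrow> restriction K_SP S P \<supseteq> restriction K_SQ S Q \<and> contraction K_SP S \<subseteq> contraction K_SQ S"
    using canonical matched_comp_matched_comp_eq_iff[OF disj(4,3) subgroups vecs_SQ]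
      matched_comp_imp_restriction_contraction[OF disj(4)]
      intvec.subspace_0[OF gen_number_lattice_imp_subspace] by metis
  have recovered_iff: "?canonical = K_PQ \<longleftrightarrow>
      restriction K_SP P S \<supseteq> restriction K_PQ P Q \<and> contraction K_SP P \<subseteq> contraction K_PQ P"
    if "gen_number_lattice (P \<union> Q) K_PQ" "matched_comp S P Q K_SP K_PQ = K_SQ" for K_PQ
    using matched_comp_matched_comp_eq_iff[OF disj(3,4) subgroups(1)
        gen_number_lattice_imp_subspace[OF that(1)] gen_number_lattice_imp_vecs[OF that(1)]]
    unfolding that(2) .
  show ?thesis
  proof (intro conjI[OF existence] conjI allI impI)
    fix K_PQ assume "gen_number_lattice (P \<union> Q) K_PQ" "matched_comp S P Q K_SP K_PQ = K_SQ"
    then show "?canonical = K_PQ \<longleftrightarrow>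
        restriction K_SP P S \<supseteq> restriction K_PQ P Q \<and> contraction K_SP P \<subseteq> contraction K_PQ P"
      by (rule recovered_iff)
  qed (metis recovered_iff)
qed

end
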